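(* Let $\{t(n)\}_{n=1}^\infty$ be a sequence of integers with $t(n)\ge 2$ for all $n$, let $\mathcal{B}_1=\{0,11\}$, and let $\mathcal{B}_n$, $\tau(n)$, $s(n)$, $l(n)$, $X_n$ ($n\in\mathbb{N}$) be constructed from these parameters as described in the context. Assume that for every $n\in\mathbb{N}$: (1) $t(n)>\frac{|\tau(n)|}{2l(n)-3s(n)}$; (2) $t(n)\ge\frac{l(n)}{l(n)-s(n)}$; (3) $t(n)\ge\frac{2s(n)+2l(n)+3|\tau(n)|}{l(n)}$; (4) $t(n)>\frac{3l(n)+|\tau(n)|}{s(n)2^{-n}}$. Then the minimal shift space $X=\bigcap_{n=1}^\infty X_n$ has the vague specification property.
   Context: $\mathbb{N}_0=\{0,1,2,\ldots\}$, $\mathbb{N}=\{1,2,\ldots\}$. Let $\mathscr{A}=\{0,1\}$ and let $\mathscr{A}^\infty$ be the set of all sequences $x=\{x_n\}_{n=0}^\infty$ over $\mathscr{A}$, with the metric $\rho(x,y)=0$ if $x=y$ and $\rho(x,y)=2^{-\min\{n: x_n\ne y_n\}}$ otherwise (compatible with the product topology). The shift map is $\sigma(x)=\{x_{n+1}\}_{n=0}^\infty$. A shift space is a nonempty, closed, $\sigma$-invariant set $X\subseteq\mathscr{A}^\infty$, viewed as the topological dynamical system $(X,\sigma)$. For a finite word $w$ over $\mathscr{A}$, $|w|$ denotes its length. Construction. Given the finite nonempty set of words $\mathcal{B}_n$, let $k(n)$ be its cardinality, enumerate its elements as $\beta^{(n)}_1,\ldots,\beta^{(n)}_{k(n)}$,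 and let $\tau(n)=\beta^{(n)}_1\ldots\beta^{(n)}_{k(n)}$ be their concatenation. Let $s(n)$ (resp. $l(n)$) be the length of the shortest (resp. longest) word in $\mathcal{B}_n$. Put $$\mathcal{B}_{n+1}=\{b_1b_2\ldots b_{t(n)}\tau(n): b_i\in\mathcal{B}_n\text{ for all }1\le i\le t(n)\}.$$ $X_n\subseteq\mathscr{A}^\infty$ is the set of all infinite concatenations of words from $\mathcal{B}_n$ together with all their shifts (images under $\sigma^k$, $k\ge0$). The shift space $X=\bigcap_n X_n$ is already known to be minimal; the claim to be proved is that it has the vague specification property. For $A\subseteq\mathbb{N}_0$ we write $d(A)=1$ if $\lim_{n\to\infty}\frac{|A\cap[0,n)|}{n}=1$. For a shift space $X$, $X^\infty$ is the set of all sequences $\underline{x}=\{x^{(n)}\}_{n=0}^\infty$ of points of $X$, with the product topology; $S(\underline{x})=\{x^{(n+1)}\}_{n=0}^\infty$; $\Gamma_\sigma=\{\{\sigma^n(z)\}_{n=0}^\infty: z\in X\}\subseteq X^\infty$. Vague pseudo-orbit: $\underline{x}\in X^\infty$ such that for every open set $\mathcal{U}\subseteq X^\infty$ containing $\Gamma_\sigma$, $d(\{n\in\mathbb{N}_0: S^n(\underline{x})\in\mathcal{U}\})=1$. Vague specification property: for every vague pseudo-orbit $\underline{x}\in X^\infty$ there is $z\in X$ such that for every $\varepsilon>0$, $d(\{n\in\mathbb{N}_0:\rho(\sigma^n(z),x^{(n)})<\varepsilon\})=1$. *)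

theory Defs
  imports "HOL-Analysis.Analysis"
begin

text \<open>
  The alphabet is \<^typ>\<open>bool\<close>, with \<^term>\<open>False\<close> for the letter 0 and \<^term>\<open>True\<close> for the letter 1.
  One-sided sequences are functions \<^typ>\<open>nat \<Rightarrow> bool\<close>; the library topology on a function type is
  the product topology, here with discrete \<^typ>\<open>bool\<close>.
\<close>

definition rho :: "(nat \<Rightarrow> bool) \<Rightarrow> (nat \<Rightarrow> bool) \<Rightarrow> real" where
  "rho x y = (if x = y then 0 else 1 / 2 ^ (LEAST n. x n \<noteq> y n))"

text \<open>
  Polymorphic, so that it serves both as the shift \<open>\<sigma>\<close> on sequences of letters and as the
  shift \<open>S\<close> on sequences of points.
\<close>

definition shift_map :: "(nat \<Rightarrow> 'a) \<Rightarrow> nat \<Rightarrow> 'a" where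
  "shift_map x = (\<lambda>n. x (Suc n))"

definition density_one :: "nat set \<Rightarrow> bool" where
  "density_one A \<longleftrightarrow> (\<lambda>n. real (card (A \<inter> {..<n})) / real n) \<longlonglongrightarrow> 1"

definition point_seqs :: "(nat \<Rightarrow> bool) set \<Rightarrow> (nat \<Rightarrow> nat \<Rightarrow> bool) set" where
  "point_seqs X = {xs. \<forall>n. xs n \<in> X}"

definition orbit_seqs :: "(nat \<Rightarrow> bool) set \<Rightarrow> (nat \<Rightarrow> nat \<Rightarrow> bool) set" where
  "orbit_seqs X = {\<lambda>n. (shift_map ^^ n) z | z. z \<in> X}"

text \<open>
  The product topology on \<open>X\<^sup>\<infinity>\<close> is the subspace topology that \<^term>\<open>point_seqs X\<close> inherits
  from the iterated product topology on \<^typ>\<open>nat \<Rightarrow> nat \<Rightarrow> bool\<close>.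
\<close>

definition vague_pseudo_orbit :: "(nat \<Rightarrow> bool) set \<Rightarrow> (nat \<Rightarrow> nat \<Rightarrow> bool) \<Rightarrow> bool" where
  "vague_pseudo_orbit X xs \<longleftrightarrow>
     xs \<in> point_seqs X \<and>
     (\<forall>U. openin (top_of_set (point_seqs X)) U \<and> orbit_seqs X \<subseteq> U \<longrightarrow>
        density_one {n. (shift_map ^^ n) xs \<in> U})"

definition vague_specification_property :: "(nat \<Rightarrow> bool) set \<Rightarrow> bool" where
  "vague_specification_property X \<longleftrightarrow>
     (\<forall>xs. vague_pseudo_orbit X xs \<longrightarrow>
        (\<exists>z\<in>X. \<forall>\<epsilon>>0. density_one {n. rho ((shift_map ^^ n) z) (xs n) < \<epsilon>}))"

text \<open>
  \<open>x\<close> is the infinite concatenation \<open>w 0 w 1 w 2 \<dots>\<close>: each finite concatenation of the \<open>w i\<close> is a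
  prefix of \<open>x\<close>. This determines \<open>x\<close> when the words are nonempty.
\<close>

definition infinite_concat :: "(nat \<Rightarrow> bool list) \<Rightarrow> (nat \<Rightarrow> bool) \<Rightarrow> bool" where
  "infinite_concat w x \<longleftrightarrow>
     (\<forall>m. let u = concat (map w [0..<m]) in map x [0..<length u] = u)"

definition concat_shift_space :: "bool list set \<Rightarrow> (nat \<Rightarrow> bool) set" where
  "concat_shift_space B =
     {(shift_map ^^ k) x | k x. \<exists>w. (\<forall>i. w i \<in> B) \<and> infinite_concat w x}"

definition next_words :: "nat \<Rightarrow> bool list \<Rightarrow> bool list set \<Rightarrow> bool list set" where
  "next_words t \<tau> B = {concat bs @ \<tau> | bs. length bs = t \<and> set bs \<subseteq> B}"

end

theory Submission
  imports Defs "HOL-Library.Omega_Words_Fun"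
begin

text \<open>
  Let \<open>y\<close> be the sequence of first letters of a vague pseudo-orbit. For every \<open>L\<close> it follows the point
  \<open>xs p\<close> for \<open>L\<close> letters from almost every position \<open>p\<close>, so for every \<open>n\<close> copying these points piece
  by piece gives a concatenation of words of \<open>B n\<close> which differs from \<open>y\<close> on a set of density zero.
  Since the lengths of the words of \<open>B n\<close> fill an interval \<open>{s n..l n}\<close> with \<open>3 * s n < 2 * l n\<close> by
  condition (1), every concatenation of words of \<open>B n\<close> can be changed, with relative error at most
  \<open>2 * (1 / 2) ^ n\<close> on every initial segment by condition (4), into one of words of \<open>B (n + 1)\<close>.
  Converting longer and longer initial parts and switching to the next approximation of \<open>y\<close> far out,
  one gets a sequence of points that converges to a point of \<open>X\<close> agreeing with \<open>y\<close> with density one.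
\<close>

section \<open>Sets of density zero\<close>

text \<open>The bound is kept free of quotients, so that several counting estimates combine by
  linear arithmetic.\<close>

definition density_zero :: "nat set \<Rightarrow> bool" where
  "density_zero A \<longleftrightarrow> (\<forall>\<epsilon>>0. \<forall>\<^sub>F n in sequentially. real (card (A \<inter> {..<n})) \<le> \<epsilon> * real n)"

lemma density_one_iff: "density_one A \<longleftrightarrow> density_zero (- A)"
proof -
  \<comment> \<open>At \<open>n = 0\<close> both quotients are \<open>0\<close> and the identity
    fails; the limit needs it only eventually.\<close>
  have quotient: "real (card (A \<inter> {..<n})) / real n - 1 = - (real (card (- A \<inter> {..<n})) / real n)"
    if "n > 0" for n
  proof -
    have "card (A \<inter> {..<n} \<union> - A \<inter> {..<n}) = card (A \<inter> {..<n}) + card (- A \<inter> {..<n})"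
      by (rule card_Un_disjoint) auto
    moreover have "A \<inter> {..<n} \<union> - A \<inter> {..<n} = {..<n}"
      by auto
    ultimately have "real n = real (card (A \<inter> {..<n})) + real (card (- A \<inter> {..<n}))"
      by (metis card_lessThan of_nat_add)
    with that show ?thesis
      by (simp add: field_simps)
  qed
  have "density_one A \<longleftrightarrow> (\<lambda>n. real (card (A \<inter> {..<n})) / real n - 1) \<longlonglongrightarrow> 0"
    unfolding density_one_def by (rule LIM_zero_iff[symmetric])
  also have "\<dots> \<longleftrightarrow> (\<lambda>n. - (real (card (- A \<inter> {..<n})) / real n)) \<longlonglongrightarrow> 0"
    by (rule tendsto_cong) (rule eventually_mono[OF eventually_gt_at_top[of 0]], rule quotient)
  also have "\<dots> \<longleftrightarrow> (\<lambda>n. real (card (- A \<inter> {..<n})) / real n) \<longlonglongrightarrow> 0"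
    using tendsto_minus_cancel_left[of "\<lambda>n. real (card (- A \<inter> {..<n})) / real n" "0::real" sequentially] by simp
  also have "\<dots> \<longleftrightarrow> density_zero (- A)"
  proof
    assume lim: "(\<lambda>n. real (card (- A \<inter> {..<n})) / real n) \<longlonglongrightarrow> 0"
    show "density_zero (- A)"
      unfolding density_zero_def
    proof (intro allI impI)
      fix \<epsilon> :: real
      assume "\<epsilon> > 0"
      then have "\<forall>\<^sub>F n in sequentially. real (card (- A \<inter> {..<n})) / real n < \<epsilon>"
        using order_tendstoD(2)[OF lim] by blast
      then show "\<forall>\<^sub>F n in sequentially. real (card (- A \<inter> {..<n})) \<le> \<epsilon> * real n"
        using eventually_gt_at_top[of 0]
        by eventually_elim (simp add: field_simps)
    qed
  next
    assume zero: "density_zero (- A)"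
    show "(\<lambda>n. real (card (- A \<inter> {..<n})) / real n) \<longlonglongrightarrow> 0"
    proof (rule tendstoI)
      fix \<epsilon> :: real
      assume "\<epsilon> > 0"
      then have "\<forall>\<^sub>F n in sequentially. real (card (- A \<inter> {..<n})) \<le> \<epsilon> / 2 * real n"
        using zero unfolding density_zero_def by (meson half_gt_zero)
      then show "\<forall>\<^sub>F n in sequentially. dist (real (card (- A \<inter> {..<n})) / real n) 0 < \<epsilon>"
        using eventually_gt_at_top[of 0]
      proof eventually_elim
        case (elim n)
        then have "real (card (- A \<inter> {..<n})) / real n \<le> \<epsilon> / 2"
          by (simp add: field_simps)
        then have "real (card (- A \<inter> {..<n})) / real n < \<epsilon>"
          using \<open>\<epsilon> > 0\<close> by linarith
        then show ?case
          by simp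
      qed
    qed
  qed
  finally show ?thesis .
qed

lemma density_zero_mono:
  assumes "density_zero B" "A \<subseteq> B"
  shows "density_zero A"
  unfolding density_zero_def
proof (intro allI impI)
  fix \<epsilon> :: real
  assume "\<epsilon> > 0"
  then have "\<forall>\<^sub>F n in sequentially. real (card (B \<inter> {..<n})) \<le> \<epsilon> * real n"
    using assms(1) by (simp add: density_zero_def)
  moreover have "card (A \<inter> {..<n}) \<le> card (B \<inter> {..<n})" for n
    using assms(2) by (intro card_mono) auto
  ultimately show "\<forall>\<^sub>F n in sequentially. real (card (A \<inter> {..<n})) \<le> \<epsilon> * real n"
    by (auto elim!: eventually_mono intro: order_trans[rotated])
qed

lemma density_zero_finite:
  assumes "finite A"
  shows "density_zero A"
  unfolding density_zero_def
proof (intro allI impI)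
  fix \<epsilon> :: real
  assume "\<epsilon> > 0"
  have "\<forall>\<^sub>F n in sequentially. real (card A) / \<epsilon> \<le> real n"
    using filterlim_real_sequentially by (auto simp: filterlim_at_top)
  then show "\<forall>\<^sub>F n in sequentially. real (card (A \<inter> {..<n})) \<le> \<epsilon> * real n"
  proof eventually_elim
    case (elim n)
    have "card (A \<inter> {..<n}) \<le> card A"
      using assms by (intro card_mono) auto
    moreover have "real (card A) \<le> \<epsilon> * real n"
      using elim \<open>\<epsilon> > 0\<close> by (simp add: field_simps)
    ultimately show ?case by linarith
  qed
qed

lemma density_zero_Un:
  assumes "density_zero A" "density_zero B"
  shows "density_zero (A \<union> B)"
  unfolding density_zero_def
proof (intro allI impI)
  fix \<epsilon> :: real
  assume "\<epsilon> > 0"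
  then have "\<forall>\<^sub>F n in sequentially. real (card (A \<inter> {..<n})) \<le> \<epsilon> / 2 * real n"
    "\<forall>\<^sub>F n in sequentially. real (card (B \<inter> {..<n})) \<le> \<epsilon> / 2 * real n"
    using assms unfolding density_zero_def by (meson half_gt_zero)+
  then show "\<forall>\<^sub>F n in sequentially. real (card ((A \<union> B) \<inter> {..<n})) \<le> \<epsilon> * real n"
  proof eventually_elim
    case (elim n)
    have "card ((A \<union> B) \<inter> {..<n}) \<le> card (A \<inter> {..<n}) + card (B \<inter> {..<n})"
      unfolding Int_Un_distrib2 by (rule card_Un_le)
    with elim show ?case by linarith
  qed
qed

lemma density_zero_UN:
  assumes "finite I" "\<And>i. i \<in> I \<Longrightarrow> density_zero (A i)"
  shows "density_zero (\<Union>i\<in>I. A i)"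
  using assms by (induction I) (auto intro: density_zero_Un density_zero_finite)

text \<open>Translation by \<open>k\<close> sends the counted positions injectively into
  \<open>A\<close> below \<open>n\<close> together with a window of \<open>k\<close> positions, and
  a fixed \<open>k\<close> is negligible against \<open>n\<close>.\<close>

lemma density_zero_shift:
  assumes "density_zero A"
  shows "density_zero {n. n + k \<in> A}"
  unfolding density_zero_def
proof (intro allI impI)
  fix \<epsilon> :: real
  assume "\<epsilon> > 0"
  then have "\<forall>\<^sub>F n in sequentially. real (card (A \<inter> {..<n})) \<le> \<epsilon> / 2 * real n"
    using assms unfolding density_zero_def by (meson half_gt_zero)
  moreover have "\<forall>\<^sub>F n in sequentially. real (2 * k) / \<epsilon> \<le> real n"
    using filterlim_real_sequentially unfolding filterlim_at_top by blast
  ultimately show "\<forall>\<^sub>F n in sequentially. real (card ({n. n + k \<in> A} \<inter> {..<n})) \<le> \<epsilon> * real n"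
  proof eventually_elim
    case (elim n)
    have "card ({n. n + k \<in> A} \<inter> {..<n}) \<le> card (A \<inter> {..<n} \<union> {n..<n + k})"
      by (rule card_inj_on_le[of "\<lambda>i. i + k"]) auto
    also have "\<dots> \<le> card (A \<inter> {..<n}) + k"
      using card_Un_le[of "A \<inter> {..<n}" "{n..<n + k}"] by simp
    finally have "real (card ({n. n + k \<in> A} \<inter> {..<n})) \<le> real (card (A \<inter> {..<n})) + real k"
      by linarith
    moreover have "real k \<le> \<epsilon> / 2 * real n"
      using elim(2) \<open>\<epsilon> > 0\<close> by (simp add: field_simps)
    ultimately show ?case
      using elim(1) by linarith
  qed
qed

section \<open>Hamming distance on initial segments\<close>

definition hamming :: "(nat \<Rightarrow> 'a) \<Rightarrow> (nat \<Rightarrow> 'a) \<Rightarrow> nat \<Rightarrow> nat" where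
  "hamming x y n = card ({i. x i \<noteq> y i} \<inter> {..<n})"

lemma hamming_triangle: "hamming x z n \<le> hamming x y n + hamming y z n"
proof -
  have "hamming x z n \<le> card (({i. x i \<noteq> y i} \<inter> {..<n}) \<union> ({i. y i \<noteq> z i} \<inter> {..<n}))"
    unfolding hamming_def by (intro card_mono) auto
  also have "\<dots> \<le> hamming x y n + hamming y z n"
    unfolding hamming_def by (rule card_Un_le)
  finally show ?thesis .
qed

lemma hamming_mono: "m \<le> n \<Longrightarrow> hamming x y m \<le> hamming x y n"
  unfolding hamming_def by (intro card_mono) auto

lemma hamming_cong: "(\<And>i. i < n \<Longrightarrow> x i = x' i) \<Longrightarrow> hamming x y n = hamming x' y n"
  unfolding hamming_def by (rule arg_cong[where f = card]) auto

lemma hamming_split_le: "hamming x y (m + k) \<le> hamming x y m + card {i \<in> {m..<m + k}. x i \<noteq> y i}"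
proof -
  have "hamming x y (m + k) \<le> card (({i. x i \<noteq> y i} \<inter> {..<m}) \<union> {i \<in> {m..<m + k}. x i \<noteq> y i})"
    unfolding hamming_def by (intro card_mono) auto
  also have "\<dots> \<le> hamming x y m + card {i \<in> {m..<m + k}. x i \<noteq> y i}"
    unfolding hamming_def by (rule card_Un_le)
  finally show ?thesis .
qed

section \<open>Concatenations of words\<close>

text \<open>The submonoid generated by \<open>B\<close> in the free monoid of words.\<close>

definition concats :: "'a list set \<Rightarrow> 'a list set" where
  "concats B = concat ` lists B"

lemma Nil_in_concats [simp]: "[] \<in> concats B"
  unfolding concats_def by (rule image_eqI[of _ _ "[]"]) auto

lemma concat_in_concats: "set ws \<subseteq> B \<Longrightarrow> concat ws \<in> concats B"
  unfolding concats_def by auto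

lemma word_in_concats: "w \<in> B \<Longrightarrow> w \<in> concats B"
  using concat_in_concats[of "[w]"] by simp

lemma append_in_concats:
  assumes "u \<in> concats B" "v \<in> concats B"
  shows "u @ v \<in> concats B"
proof -
  obtain us vs where "us \<in> lists B" "u = concat us" "vs \<in> lists B" "v = concat vs"
    using assms unfolding concats_def by blast
  then show ?thesis
    unfolding concats_def by (intro image_eqI[of _ _ "us @ vs"]) auto
qed

lemma concats_subset:
  assumes "A \<subseteq> concats B"
  shows "concats A \<subseteq> concats B"
proof -
  have "concat ws \<in> concats B" if "ws \<in> lists A" for ws
    using that by (induction ws) (use assms append_in_concats in auto)
  then show ?thesis
    unfolding concats_def[of A] by auto
qed

text \<open>
  Arbitrarily long prefixes decompose; for a finite \<open>B\<close> without the empty word this is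
  equivalent to being an infinite concatenation, but it passes to limits and to refinements of \<open>B\<close>
  without any choice of decompositions.
\<close>

definition factorable :: "'a list set \<Rightarrow> (nat \<Rightarrow> 'a) \<Rightarrow> bool" where
  "factorable B x \<longleftrightarrow> (\<forall>N. \<exists>k\<ge>N. prefix k x \<in> concats B)"

lemma factorable_mono: "A \<subseteq> concats B \<Longrightarrow> factorable A x \<Longrightarrow> factorable B x"
  unfolding factorable_def using concats_subset by blast

lemma factorable_conc:
  assumes "v \<in> concats B" "factorable B x"
  shows "factorable B (v \<frown> x)"
  unfolding factorable_def
proof
  fix N
  obtain k where "k \<ge> N" "prefix k x \<in> concats B"
    using assms(2) unfolding factorable_def by blast
  then have "prefix (length v + k) (v \<frown> x) \<in> concats B"
    using append_in_concats[OF assms(1)] by simp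
  with \<open>k \<ge> N\<close> show "\<exists>k\<ge>N. prefix k (v \<frown> x) \<in> concats B"
    by (meson trans_le_add2)
qed

text \<open>A compactness argument: every factored nonempty prefix begins with a word of
  \<open>B\<close>, and since \<open>B\<close> is finite one word begins infinitely many of them.
  Removing it leaves arbitrarily long factored prefixes of the tail.\<close>

lemma factorable_first_word:
  assumes "finite B" "factorable B x"
  obtains b where "b \<in> B" "prefix (length b) x = b" "factorable B (suffix (length b) x)"
proof -
  have "\<exists>b ws k. b \<in> B \<and> ws \<in> lists B \<and> k \<ge> N \<and> k > 0 \<and> prefix k x = b @ concat ws" for N
  proof -
    \<comment> \<open>Length at least \<open>Suc N\<close> rules out the empty factorization when
      \<open>N = 0\<close>.\<close>
    obtain k where k: "k \<ge> Suc N" "prefix k x \<in> concats B"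
      using assms(2) unfolding factorable_def by blast
    then obtain vs where vs: "vs \<in> lists B" "prefix k x = concat vs"
      unfolding concats_def by blast
    with k have "vs \<noteq> []"
      using subsequence_length[of x 0 k] by fastforce
    then obtain b ws where "vs = b # ws"
      by (cases vs) auto
    with vs k show ?thesis
      by (intro exI[of _ b] exI[of _ ws] exI[of _ k]) auto
  qed
  then obtain b ws k where
    step: "\<And>N. b N \<in> B \<and> ws N \<in> lists B \<and> k N \<ge> N \<and> prefix (k N) x = b N @ concat (ws N)"
    by metis
  obtain c where "c \<in> B" and often: "infinite {N. b N = c}"
  proof -
    have "\<exists>c\<in>B. infinite {N \<in> UNIV. b N = c}"
      by (rule pigeonhole_infinite_rel) (use assms(1) step in auto)
    then show ?thesis
      using that by auto
  qed
  have decomposition: "prefix (length c) x = c \<and> prefix (k N - length c) (suffix (length c) x) = concat (ws N)"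
    if "b N = c" for N
  proof -
    have *: "prefix (k N) x = c @ concat (ws N)"
      using step[of N] that by simp
    then have "length c \<le> k N"
      by (metis diff_zero le_add1 length_append subsequence_length)
    then have "prefix (length c) x = take (length c) (prefix (k N) x)"
      by simp
    moreover have "prefix (k N - length c) (suffix (length c) x) = drop (length c) (prefix (k N) x)"
      using \<open>length c \<le> k N\<close> by simp
    ultimately show ?thesis
      using * by simp
  qed
  have "factorable B (suffix (length c) x)"
    unfolding factorable_def
  proof
    fix M
    obtain N where "N > M + length c" "b N = c"
      using often unfolding infinite_nat_iff_unbounded by blast
    then have "k N - length c \<ge> M"
      using step[of N] by linarith
    moreover have "prefix (k N - length c) (suffix (length c) x) \<in> concats B"
      using decomposition[OF \<open>b N = c\<close>] step[of N] unfolding concats_def by auto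
    ultimately show "\<exists>k\<ge>M. prefix k (suffix (length c) x) \<in> concats B"
      by blast
  qed
  moreover obtain N where "b N = c"
    using often by (metis (mono_tags, lifting) Collect_empty_eq finite.emptyI)
  ultimately show ?thesis
    using that \<open>c \<in> B\<close> decomposition by blast
qed

lemma factorable_words:
  assumes "finite B" "factorable B x"
  obtains ws where "length ws = n" "set ws \<subseteq> B" "prefix (length (concat ws)) x = concat ws"
    "factorable B (suffix (length (concat ws)) x)"
proof -
  have "\<exists>ws. length ws = n \<and> set ws \<subseteq> B \<and> prefix (length (concat ws)) x = concat ws \<and>
      factorable B (suffix (length (concat ws)) x)"
    using assms(2)
  proof (induction n arbitrary: x)
    case 0
    then show ?case by simp
  next
    case (Suc n)
    obtain b where b: "b \<in> B" "prefix (length b) x = b" "factorable B (suffix (length b) x)"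
      using factorable_first_word[OF assms(1) Suc.prems] .
    from Suc.IH[OF b(3)] obtain ws where ws: "length ws = n" "set ws \<subseteq> B"
      "prefix (length (concat ws)) (suffix (length b) x) = concat ws"
      "factorable B (suffix (length (concat ws)) (suffix (length b) x))"
      by blast
    have "prefix (length (concat (b # ws))) x = concat (b # ws)"
      using b(2) ws(3) subsequence_append[of x "length b" "length (concat ws)"] by simp
    moreover have "factorable B (suffix (length (concat (b # ws))) x)"
      using ws(4) by simp
    moreover have "length (b # ws) = Suc n \<and> set (b # ws) \<subseteq> B"
      using b(1) ws(1,2) by simp
    ultimately show ?case
      by blast
  qed
  then show ?thesis
    using that by blast
qed

text \<open>Cut points have gaps at most \<open>l\<close>: a cut beyond \<open>N\<close> still
  serves \<open>Suc N\<close>, and a cut exactly at \<open>N\<close> is moved on by one nonempty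
  word.\<close>

lemma factorable_split:
  assumes "finite B" "factorable B x" "\<And>b. b \<in> B \<Longrightarrow> 0 < length b \<and> length b \<le> l"
  obtains k where "N \<le> k" "k \<le> N + l" "prefix k x \<in> concats B" "factorable B (suffix k x)"
proof -
  have "\<exists>k\<ge>N. k \<le> N + l \<and> prefix k x \<in> concats B \<and> factorable B (suffix k x)"
  proof (induction N)
    case 0
    then show ?case
      using assms(2) by (intro exI[of _ 0]) auto
  next
    case (Suc N)
    then obtain k where k: "k \<ge> N" "k \<le> N + l" "prefix k x \<in> concats B" "factorable B (suffix k x)"
      by blast
    show ?case
    proof (cases "k = N")
      case True
      obtain b where b: "b \<in> B" "prefix (length b) (suffix k x) = b"
        "factorable B (suffix (length b) (suffix k x))"
        using factorable_first_word[OF assms(1) k(4)] .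
      have "prefix (k + length b) x \<in> concats B"
        unfolding subsequence_append using k(3) b(1,2) by (simp add: append_in_concats word_in_concats)
      moreover have "factorable B (suffix (k + length b) x)"
        using b(3) by simp
      moreover have "Suc N \<le> k + length b \<and> k + length b \<le> Suc N + l"
        using assms(3)[OF b(1)] True by linarith
      ultimately show ?thesis
        by blast
    next
      case False
      with k have "Suc N \<le> k \<and> k \<le> Suc N + l"
        by linarith
      with k(3,4) show ?thesis
        by blast
    qed
  qed
  then show ?thesis
    using that by blast
qed

text \<open>The factorable sequences form a closed set. The approximating \<open>x\<close> has to
  agree with \<open>z\<close> on \<open>N + l\<close> letters, because its first usable cut may lie
  as late as \<open>N + l\<close>.\<close>

lemma factorable_limit:
  assumes "finite B" "\<And>b. b \<in> B \<Longrightarrow> 0 < length b"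
    and approx: "\<And>N. \<exists>x. factorable B x \<and> (\<forall>i<N. x i = z i)"
  shows "factorable B z"
  unfolding factorable_def
proof
  fix N
  define l where "l = Max (length ` B)"
  have l: "0 < length b \<and> length b \<le> l" if "b \<in> B" for b
    using assms(1,2) that by (simp add: l_def)
  obtain x where x: "factorable B x" "\<forall>i<N + l. x i = z i"
    using approx by blast
  obtain k where k: "N \<le> k" "k \<le> N + l" "prefix k x \<in> concats B"
    using factorable_split[OF assms(1) x(1) l, where N = N] .
  have "prefix k x = prefix k z"
    using k(2) x(2) by (auto simp: subsequence_def)
  with k show "\<exists>k\<ge>N. prefix k z \<in> concats B"
    by metis
qed

text \<open>
  The positions in \<open>P\<close> are the admissible starting points of a block, and \<open>Q p v\<close> is the
  requirement on the block \<open>v\<close> placed at \<open>p\<close>.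
\<close>

lemma concatenation_from_blocks:
  assumes "0 \<in> P"
    and step: "\<And>p. p \<in> P \<Longrightarrow> \<exists>v. v \<noteq> [] \<and> p + length v \<in> P \<and> Q p v"
  obtains x q where "q 0 = 0" "strict_mono q" "\<And>i. q i \<in> P"
    "\<And>i. Q (q i) (subsequence x (q i) (q (Suc i)))"
proof -
  obtain f where f: "\<And>p. p \<in> P \<Longrightarrow> f p \<noteq> [] \<and> p + length (f p) \<in> P \<and> Q p (f p)"
    using step by metis
  define q where "q = rec_nat 0 (\<lambda>_ p. p + length (f p))"
  have q_0: "q 0 = 0" and q_Suc: "q (Suc i) = q i + length (f (q i))" for i
    by (auto simp: q_def)
  have q_P: "q i \<in> P" for i
    by (induction i) (use assms(1) f in \<open>auto simp: q_0 q_Suc\<close>)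
  have mono: "strict_mono q"
    unfolding strict_mono_Suc_iff using f[OF q_P] by (simp add: q_Suc)
  \<comment> \<open>The index of the block that contains position \<open>j\<close>.\<close>
  define idx where "idx j = (LEAST i. j < q (Suc i))" for j
  have idx: "idx j = i" if "q i \<le> j" "j < q (Suc i)" for i j
    unfolding idx_def
  proof (rule Least_equality)
    fix i'
    assume "j < q (Suc i')"
    then have "q i < q (Suc i')"
      using that(1) by linarith
    then show "i \<le> i'"
      using strict_mono_less[OF mono] by auto
  qed (rule that(2))
  define x where "x j = f (q (idx j)) ! (j - q (idx j))" for j
  have "subsequence x (q i) (q (Suc i)) = f (q i)" for i
  proof (rule nth_equalityI)
    fix j
    assume "j < length (subsequence x (q i) (q (Suc i)))"
    then have "j < length (f (q i))"
      by (simp add: q_Suc)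
    moreover from this have "idx (q i + j) = i"
      by (intro idx) (auto simp: q_Suc)
    ultimately show "subsequence x (q i) (q (Suc i)) ! j = f (q i) ! j"
      by (simp add: q_Suc x_def)
  qed (simp add: q_Suc)
  then show ?thesis
    using that[of q x] q_0 mono q_P f by simp
qed

lemma block_of_index:
  fixes q :: "nat \<Rightarrow> nat"
  assumes "q 0 = 0" "strict_mono q"
  obtains i where "q i \<le> N" "N < q (Suc i)"
proof -
  have "\<exists>i. N < q i"
    using strict_mono_imp_increasing[OF assms(2), of "Suc N"] by (intro exI[of _ "Suc N"]) simp
  then obtain i where i: "N < q i" "\<forall>j<i. \<not> N < q j"
    using exists_least_iff[of "\<lambda>i. N < q i"] by blast
  then obtain j where "i = Suc j"
    using assms(1) by (cases i) auto
  with i show ?thesis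
    using that[of j] by auto
qed

lemma factorable_blocks:
  assumes "q 0 = 0" "strict_mono q" "\<And>i. subsequence x (q i) (q (Suc i)) \<in> concats B"
  shows "factorable B x"
proof -
  have "prefix (q i) x \<in> concats B" for i
  proof (induction i)
    case 0
    then show ?case using assms(1) by simp
  next
    case (Suc i)
    have "q i \<le> q (Suc i)"
      using assms(2) by (simp add: strict_mono_less_eq)
    then have "prefix (q (Suc i)) x = prefix (q i) x @ subsequence x (q i) (q (Suc i))"
      using subsequence_append[of x "q i" "q (Suc i) - q i"] by simp
    then show ?case
      using Suc assms(3) by (simp add: append_in_concats)
  qed
  then show ?thesis
    unfolding factorable_def using assms(2) strict_mono_imp_increasing by blast
qed

section \<open>Codes whose word lengths fill an interval\<close>

text \<open>Aligning two concatenations depends on word lengths only. Lengths filling an interval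
  make all needed totals available, and the property is inherited by the next code.\<close>

locale interval_code =
  fixes B :: "bool list set" and s l :: nat
  assumes finite_B: "finite B"
    and lengths: "length ` B = {s..l}"
    and s_pos: "0 < s"
    and s_less_l: "s < l"
begin

lemma word_length: "b \<in> B \<Longrightarrow> s \<le> length b \<and> length b \<le> l"
  using lengths by (metis atLeastAtMost_iff imageI)

lemma word_length_pos: "b \<in> B \<Longrightarrow> 0 < length b \<and> length b \<le> l"
  using word_length s_pos by fastforce

lemma length_concat_bounds:
  assumes "set ws \<subseteq> B"
  shows "length ws * s \<le> length (concat ws) \<and> length (concat ws) \<le> length ws * l"
  using assms
proof (induction ws)
  case (Cons b ws)
  then show ?case
    using word_length[of b] by (simp add: add_mono)
qed simp

lemma length_concat_surj:
  assumes "k * s \<le> m" "m \<le> k * l"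
  obtains ws where "length ws = k" "set ws \<subseteq> B" "length (concat ws) = m"
proof -
  have "\<exists>ws. length ws = k \<and> set ws \<subseteq> B \<and> length (concat ws) = m"
    using assms
  proof (induction k arbitrary: m)
    case 0
    then show ?case by simp
  next
    case (Suc k)
    \<comment> \<open>The shortest admissible first word: at least \<open>s\<close>, and long enough
      for the other \<open>k\<close> words to supply the rest.\<close>
    define r where "r = max s (m - k * l)"
    have r: "s \<le> r" "r \<le> l" "k * s \<le> m - r" "m - r \<le> k * l" "r \<le> m"
    proof -
      have "k * s \<le> k * l"
        using s_less_l by (intro mult_le_mono2) simp
      moreover have "s + k * s \<le> m" "m \<le> l + k * l"
        using Suc.prems by simp_all
      ultimately show "s \<le> r" "r \<le> l" "k * s \<le> m - r" "m - r \<le> k * l" "r \<le> m"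
        unfolding r_def using s_less_l by linarith+
    qed
    have "r \<in> length ` B"
      unfolding lengths using r by simp
    then obtain b where b: "b \<in> B" "length b = r"
      by blast
    obtain ws where "length ws = k" "set ws \<subseteq> B" "length (concat ws) = m - r"
      using Suc.IH[OF r(3,4)] by blast
    with b r(5) show ?case
      by (intro exI[of _ "b # ws"]) simp
  qed
  then show ?thesis
    using that by blast
qed

text \<open>With \<open>k = m div s\<close> words, the remainder is below \<open>s\<close>, and
  \<open>s \<le> k\<close> by the assumed threshold. Hence \<open>m\<close> lies between
  \<open>k * s\<close> and \<open>k * (s + 1)\<close>, which is at most
  \<open>k * l\<close>.\<close>

lemma filler:
  assumes "s * s \<le> m"
  obtains w where "w \<in> concats B" "length w = m"
proof -
  define k where "k = m div s"
  have "s \<le> k"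
    unfolding k_def using assms s_pos by (simp add: less_eq_div_iff_mult_less_eq)
  have "k * s \<le> m"
    by (simp add: k_def)
  have "m < k * s + s"
    unfolding k_def using mod_less_divisor[OF s_pos, of m] div_mult_mod_eq[of m s] by linarith
  also have "\<dots> \<le> k * Suc s"
    using \<open>s \<le> k\<close> by simp
  also have "\<dots> \<le> k * l"
    using s_less_l by (intro mult_le_mono2) simp
  finally obtain ws where "set ws \<subseteq> B" "length (concat ws) = m"
    using length_concat_surj[OF \<open>k * s \<le> m\<close>] by (metis less_imp_le)
  then show ?thesis
    using that concat_in_concats by blast
qed

text \<open>A filler joins a cut of \<open>x\<close> at or after \<open>K\<close> to a cut of
  \<open>y\<close> far enough on for the filler to exist. Each search for a cut costs at most
  \<open>l\<close>, the filler's threshold \<open>s * s\<close>.\<close>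

lemma factorable_glue:
  assumes "factorable B x" "factorable B y"
  obtains z where "factorable B z" "\<And>i. i < K \<Longrightarrow> z i = x i"
    "\<And>i. K + (s * s + 2 * l) \<le> i \<Longrightarrow> z i = y i"
proof -
  obtain j where j: "K \<le> j" "j \<le> K + l" "prefix j x \<in> concats B"
    using factorable_split[OF finite_B assms(1) word_length_pos, where N = K] by blast
  obtain k where k: "j + s * s \<le> k" "k \<le> j + s * s + l" "factorable B (suffix k y)"
    using factorable_split[OF finite_B assms(2) word_length_pos, where N = "j + s * s"] by blast
  obtain w where w: "w \<in> concats B" "length w = k - j"
    using filler[of "k - j"] k(1) by (metis add_le_imp_le_diff add.commute)
  define z where "z = (prefix j x @ w) \<frown> suffix k y"
  have len: "length (prefix j x @ w) = k"
    using w(2) k(1) by simp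
  show ?thesis
  proof (rule that[of z])
    show "factorable B z"
      unfolding z_def by (intro factorable_conc append_in_concats j(3) w(1) k(3))
    show "z i = x i" if "i < K" for i
      using that j(1) len unfolding z_def by (subst conc_fst) (auto simp: nth_append)
    show "z i = y i" if "K + (s * s + 2 * l) \<le> i" for i
    proof -
      have "k \<le> i"
        using that j(2) k(2) by linarith
      then show ?thesis
        unfolding z_def using len by (subst conc_snd) auto
    qed
  qed
qed

text \<open>
  The first \<open>t - 3\<close> words of each new word are kept. The next three words and the copy of \<open>\<tau>\<close> may
  have any total length between \<open>3 * s + length \<tau>\<close> and \<open>3 * l + length \<tau>\<close>, a window of width at
  least \<open>l\<close>, so the new word can be made to end where some old word ends.
\<close>

lemma factorable_next_words:
  fixes \<delta> :: real
  assumes x: "factorable B x"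
    and ratio: "3 * s \<le> 2 * l"
    and t: "3 \<le> t"
    and \<delta>: "real (3 * l + length \<tau>) \<le> \<delta> * real ((t - 3) * s)"
  obtains y where "factorable (next_words t \<tau> B) y"
    "\<And>i. i < (t - 3) * s \<Longrightarrow> y i = x i"
    "\<And>N. real (hamming x y N) \<le> \<delta> * real N"
proof -
  define a where "a = (t - 3) * s"
  have "0 < l"
    using s_less_l by simp
  then have "0 < \<delta> * real a"
    using \<delta> unfolding a_def by linarith
  \<comment> \<open>Both signs follow because the left side of the assumed bound is
    positive.\<close>
  then have "0 < \<delta>" "0 < a"
    by (auto simp: zero_less_mult_iff)
  \<comment> \<open>Here \<open>m\<close> counts the letters copied from \<open>x\<close> before the
    three free words and \<open>\<tau>\<close>.\<close>
  define Q where "Q p v \<longleftrightarrow> v \<in> next_words t \<tau> B \<and>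
      (\<exists>m\<ge>a. m \<le> length v \<and> length v \<le> m + (3 * l + length \<tau>) \<and> (\<forall>i<m. v ! i = x (p + i)))" for p v
  define P where "P = {p. factorable B (suffix p x)}"
  have "0 \<in> P"
    unfolding P_def using x by simp
  have "\<exists>v. v \<noteq> [] \<and> p + length v \<in> P \<and> Q p v" if "p \<in> P" for p
  proof -
    have "factorable B (suffix p x)"
      using that by (simp add: P_def)
    from factorable_words[OF finite_B this, where n = "t - 3"] obtain bs where
      bs: "length bs = t - 3" "set bs \<subseteq> B"
      "prefix (length (concat bs)) (suffix p x) = concat bs"
      "factorable B (suffix (length (concat bs)) (suffix p x))" .
    define m where "m = length (concat bs)"
    have "a \<le> m"
      using length_concat_bounds[OF bs(2)] bs(1) by (simp add: a_def m_def)
    have "factorable B (suffix (p + m) x)"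
      using bs(4) by (simp add: m_def)
    from factorable_split[OF finite_B this word_length_pos, where N = "3 * s + length \<tau>"] obtain k where
      k: "3 * s + length \<tau> \<le> k" "k \<le> 3 * s + length \<tau> + l" "factorable B (suffix k (suffix (p + m) x))"
      by blast
    \<comment> \<open>The upper bound is where \<open>ratio\<close> enters: the cut may overshoot
      \<open>3 * s\<close> by \<open>l\<close>, and three words must still reach it.\<close>
    have "3 * s \<le> k - length \<tau>" "k - length \<tau> \<le> 3 * l"
      using k(1,2) ratio by linarith+
    then obtain cs where cs: "length cs = 3" "set cs \<subseteq> B" "length (concat cs) = k - length \<tau>"
      by (rule length_concat_surj)
    define v where "v = concat (bs @ cs) @ \<tau>"
    have "v \<in> next_words t \<tau> B"
      unfolding next_words_def v_def using bs(1,2) cs(1,2) t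
      by (intro CollectI exI[of _ "bs @ cs"]) auto
    moreover have len: "length v = m + k"
      unfolding v_def m_def using cs(3) k(1) by simp
    moreover have "v ! i = x (p + i)" if "i < m" for i
    proof -
      have "v ! i = concat bs ! i"
        using that by (simp add: v_def m_def nth_append)
      also have "\<dots> = prefix (length (concat bs)) (suffix p x) ! i"
        unfolding bs(3) ..
      also have "\<dots> = x (p + i)"
        using that by (simp add: m_def)
      finally show ?thesis .
    qed
    moreover have "k \<le> 3 * l + length \<tau>"
      using \<open>k - length \<tau> \<le> 3 * l\<close> by linarith
    ultimately have "Q p v"
      unfolding Q_def using \<open>a \<le> m\<close> by (intro conjI exI[of _ m]) auto
    moreover have "v \<noteq> []"
      using len \<open>a \<le> m\<close> \<open>0 < a\<close> by auto
    moreover have "p + length v \<in> P"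
      using k(3) by (simp add: P_def len add.assoc)
    ultimately show ?thesis
      by blast
  qed
  from concatenation_from_blocks[where Q = Q, OF \<open>0 \<in> P\<close> this] obtain y q where
    q: "q 0 = 0" "strict_mono q" and block: "\<And>i. Q (q i) (subsequence y (q i) (q (Suc i)))"
    by metis
  have kept: "\<exists>m\<ge>a. m \<le> q (Suc i) - q i \<and> q (Suc i) - q i \<le> m + (3 * l + length \<tau>) \<and>
      (\<forall>j<m. y (q i + j) = x (q i + j))" for i
  proof -
    obtain m where "m \<ge> a" "m \<le> q (Suc i) - q i" "q (Suc i) - q i \<le> m + (3 * l + length \<tau>)"
      "\<forall>j<m. subsequence y (q i) (q (Suc i)) ! j = x (q i + j)"
      using block[of i] unfolding Q_def by auto
    then show ?thesis
      by (intro exI[of _ m]) auto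
  qed
  \<comment> \<open>Errors start only after at least \<open>a\<close> correct letters, and a block
    has at most \<open>3 * l + length \<tau>\<close> of them, which is at most
    \<open>\<delta> * a\<close>. So the bound holds at every point inside a block and not only at
    its end.\<close>
  have within: "real (hamming x y (q i + r)) \<le> real (hamming x y (q i)) + \<delta> * real r"
    if "r \<le> q (Suc i) - q i" for i r
  proof -
    obtain m where m: "m \<ge> a" "q (Suc i) - q i \<le> m + (3 * l + length \<tau>)"
      "\<forall>j<m. y (q i + j) = x (q i + j)"
      using kept by blast
    have subset: "{j \<in> {q i..<q i + r}. x j \<noteq> y j} \<subseteq> {q i + m..<q i + r}"
    proof
      fix j
      assume j: "j \<in> {j \<in> {q i..<q i + r}. x j \<noteq> y j}"
      have "\<not> j - q i < m"
        using m(3)[rule_format, of "j - q i"] j by auto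
      with j show "j \<in> {q i + m..<q i + r}"
        by auto
    qed
    have card: "card {j \<in> {q i..<q i + r}. x j \<noteq> y j} \<le> r - m"
      using card_mono[OF _ subset] by simp
    have "real (r - m) \<le> \<delta> * real r"
    proof (cases "r \<le> m")
      case True
      then show ?thesis
        using \<open>0 < \<delta>\<close> by simp
    next
      case False
      have "real (r - m) \<le> real (3 * l + length \<tau>)"
        using that m(2) by linarith
      also have "\<dots> \<le> \<delta> * real a"
        using \<delta> by (simp add: a_def)
      also have "\<dots> \<le> \<delta> * real r"
        using \<open>0 < \<delta>\<close> False m(1) by simp
      finally show ?thesis .
    qed
    with card hamming_split_le[of x y "q i" r] show ?thesis
      by linarith
  qed
  have boundary: "real (hamming x y (q i)) \<le> \<delta> * real (q i)" for i
  proof (induction i)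
    case 0
    then show ?case
      by (simp add: q(1) hamming_def)
  next
    case (Suc i)
    have le: "q i \<le> q (Suc i)"
      using q(2) by (simp add: strict_mono_less_eq)
    have "\<delta> * real (q (Suc i)) = \<delta> * real (q i) + \<delta> * real (q (Suc i) - q i)"
      using le by (simp add: algebra_simps)
    with within[OF order_refl, of i] Suc le show ?case
      by simp
  qed
  show ?thesis
  proof (rule that[of y])
    show "factorable (next_words t \<tau> B) y"
      using q block by (intro factorable_blocks) (auto simp: Q_def intro: word_in_concats)
    show "y i = x i" if "i < (t - 3) * s" for i
      using kept[of 0] q(1) that unfolding a_def by auto
    show "real (hamming x y N) \<le> \<delta> * real N" for N
    proof -
      obtain i where i: "q i \<le> N" "N < q (Suc i)"
        using block_of_index[OF q] by blast
      have "\<delta> * real N = \<delta> * real (q i) + \<delta> * real (N - q i)"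
        using i(1) by (simp add: algebra_simps)
      moreover have "real (hamming x y N) \<le> real (hamming x y (q i)) + \<delta> * real (N - q i)"
        using within[of "N - q i" i] i by simp
      ultimately show ?thesis
        using boundary[of i] by linarith
    qed
  qed
qed

end

section \<open>Factorable sequences and infinite concatenations\<close>

lemma funpow_shift_map: "(shift_map ^^ k) x = suffix k x"
  by (induction k) (auto simp: shift_map_def)

lemma infinite_concat_imp_factorable:
  assumes "\<And>i. w i \<in> B" "infinite_concat w x" "\<And>b. b \<in> B \<Longrightarrow> 0 < length b"
  shows "factorable B x"
  unfolding factorable_def
proof
  fix N
  let ?u = "concat (map w [0..<N])"
  have "N \<le> length ?u"
  proof (induction N)
    case (Suc N)
    have "0 < length (w N)"
      by (intro assms)
    moreover have "length (concat (map w [0..<Suc N])) = length (concat (map w [0..<N])) + length (w N)"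
      by simp
    ultimately show ?case
      using Suc by linarith
  qed simp
  moreover have "prefix (length ?u) x = ?u"
    using assms(2) unfolding infinite_concat_def subsequence_def Let_def by blast
  moreover have "?u \<in> concats B"
    using assms(1) by (intro concat_in_concats) auto
  ultimately show "\<exists>k\<ge>N. prefix k x \<in> concats B"
    by metis
qed

lemma factorable_imp_infinite_concat:
  fixes B :: "bool list set"
  assumes "finite B" "factorable B x"
  obtains w where "\<And>i. w i \<in> B" "infinite_concat w x"
proof -
  \<comment> \<open>The state is the current cut and the word just read. The clause for
    \<open>n = 0\<close> pins the first cut, which dependent choice would otherwise leave
    open.\<close>
  have "\<exists>f. \<forall>n. (factorable B (suffix (fst (f n)) x) \<and> (n = 0 \<longrightarrow> fst (f n) = 0)) \<and>
    (snd (f (Suc n)) \<in> B \<and> fst (f (Suc n)) = fst (f n) + length (snd (f (Suc n))) \<and>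
     prefix (fst (f (Suc n))) x = prefix (fst (f n)) x @ snd (f (Suc n)))"
  proof (rule dependent_nat_choice)
    show "\<exists>a :: nat \<times> bool list. factorable B (suffix (fst a) x) \<and> ((0::nat) = 0 \<longrightarrow> fst a = 0)"
      using assms(2) by (intro exI[of _ "(0, [])"]) (simp add: suffix_def)
  next
    fix a :: "nat \<times> bool list" and n :: nat
    assume a: "factorable B (suffix (fst a) x) \<and> (n = 0 \<longrightarrow> fst a = 0)"
    then obtain b where b: "b \<in> B" "prefix (length b) (suffix (fst a) x) = b"
      "factorable B (suffix (length b) (suffix (fst a) x))"
      using factorable_first_word[OF assms(1)] by blast
    let ?c = "(fst a + length b, b)"
    have "factorable B (suffix (fst ?c) x)"
      using b(3) by simp
    moreover have "prefix (fst ?c) x = prefix (fst a) x @ snd ?c"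
      using subsequence_append[of x "fst a" "length b"] b(2) by simp
    ultimately show "\<exists>c. (factorable B (suffix (fst c) x) \<and> (Suc n = 0 \<longrightarrow> fst c = 0)) \<and>
        snd c \<in> B \<and> fst c = fst a + length (snd c) \<and> prefix (fst c) x = prefix (fst a) x @ snd c"
      using b(1) by (intro exI[of _ ?c]) simp
  qed
  then obtain f where f: "\<And>n. snd (f (Suc n)) \<in> B"
    "\<And>n. prefix (fst (f (Suc n))) x = prefix (fst (f n)) x @ snd (f (Suc n))" "fst (f 0) = 0"
    by blast
  define w where "w n = snd (f (Suc n))" for n
  have "prefix (fst (f m)) x = concat (map w [0..<m])" for m
    by (induction m) (use f in \<open>auto simp: w_def\<close>)
  then have "prefix (length (concat (map w [0..<m]))) x = concat (map w [0..<m])" for m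
    by (metis diff_zero subsequence_length)
  then have "infinite_concat w x"
    unfolding infinite_concat_def subsequence_def Let_def by blast
  then show ?thesis
    using that[of w] f(1) by (simp add: w_def)
qed

lemma factorable_imp_in_concat_shift_space:
  assumes "finite B" "factorable B x"
  shows "x \<in> concat_shift_space B"
proof -
  obtain w where "\<And>i. w i \<in> B" "infinite_concat w x"
    using factorable_imp_infinite_concat[OF assms] by blast
  then show ?thesis
    unfolding concat_shift_space_def by (intro CollectI exI[of _ 0] exI[of _ x]) auto
qed

lemma shift_concat_shift_space: "x \<in> concat_shift_space B \<Longrightarrow> shift_map x \<in> concat_shift_space B"
  unfolding concat_shift_space_def by clarify (metis comp_apply funpow.simps(2))

section \<open>Approximation up to density zero\<close>

context interval_code
begin

text \<open>A point of the shift space may begin inside a word, so it decomposes only from some cut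
  on; the cuts are those of the concatenation it is a shift of.\<close>

lemma factorable_tail:
  assumes "x \<in> concat_shift_space B"
  obtains j where "N \<le> j" "j \<le> N + l" "factorable B (suffix j x)"
proof -
  obtain k x0 w where x: "x = suffix k x0" and w: "\<And>i. w i \<in> B" "infinite_concat w x0"
    using assms unfolding concat_shift_space_def funpow_shift_map by blast
  have "factorable B x0"
    using infinite_concat_imp_factorable w word_length_pos by blast
  then obtain j where j: "k + N \<le> j" "j \<le> k + N + l" "factorable B (suffix j x0)"
    using factorable_split[OF finite_B _ word_length_pos, where N = "k + N"] by blast
  then have "factorable B (suffix (j - k) x)"
    by (simp add: x)
  with j(1,2) show ?thesis
    by (intro that[of "j - k"]) auto
qed

text \<open>
  Greedy choice of blocks: at a position \<open>p\<close> where \<open>y\<close> follows \<open>xs p\<close> for \<open>L\<close> letters, a filler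
  leads to a place where \<open>xs p\<close> is cut into words of \<open>B\<close>, and then \<open>xs p\<close> is copied. A block has
  boundedly many errors, and is long unless its starting point is exceptional.
\<close>

lemma factorable_density_zero_approximation:
  assumes xs: "\<And>p. xs p \<in> concat_shift_space B"
    and agree: "\<And>L. density_one {p. \<forall>i<L. y (p + i) = xs p i}"
  obtains u where "factorable B u" "density_zero {i. u i \<noteq> y i}"
proof -
  \<comment> \<open>At most \<open>s * s + l\<close> errors come from the filler and at most
    \<open>s * s + 2 * l\<close> from the letters after index \<open>L\<close>.\<close>
  define C where "C = 2 * (s * s) + 3 * l"
  define Q where "Q p v \<longleftrightarrow> v \<in> concats B \<and> card {i. i < length v \<and> v ! i \<noteq> y (p + i)} \<le> C \<and>
      (\<forall>L\<le>p. (\<forall>i<L. y (p + i) = xs p i) \<longrightarrow> L \<le> length v)" for p v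
  have "\<exists>v. v \<noteq> [] \<and> p + length v \<in> UNIV \<and> Q p v" for p
  proof -
    \<comment> \<open>The cap \<open>L \<le> p\<close> makes the maximum exist even if
      \<open>y\<close> follows \<open>xs p\<close> forever; for a fixed length it excludes finitely
      many \<open>p\<close> only.\<close>
    let ?A = "{L. L \<le> p \<and> (\<forall>i<L. y (p + i) = xs p i)}"
    define L where "L = Max ?A"
    have "finite ?A" "0 \<in> ?A"
      by auto
    then have "L \<in> ?A" and L_ge: "\<And>L'. L' \<in> ?A \<Longrightarrow> L' \<le> L"
      unfolding L_def using Max_in[of ?A] Max_ge[of ?A] by blast+
    obtain j where j: "s * s \<le> j" "j \<le> s * s + l" "factorable B (suffix j (xs p))"
      using factorable_tail[OF xs] by blast
    obtain f where f: "f \<in> concats B" "length f = j"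
      using filler[OF j(1)] by blast
    obtain k where k: "L \<le> k" "k \<le> L + l" "prefix k (suffix j (xs p)) \<in> concats B"
      using factorable_split[OF finite_B j(3) word_length_pos, where N = L] by blast
    define v where "v = f @ prefix k (suffix j (xs p))"
    have len: "length v = j + k"
      by (simp add: v_def f(2))
    have "v \<in> concats B"
      unfolding v_def by (intro append_in_concats f(1) k(3))
    moreover have "{i. i < length v \<and> v ! i \<noteq> y (p + i)} \<subseteq> {..<j} \<union> {L..<j + k}"
    proof
      fix i
      assume i: "i \<in> {i. i < length v \<and> v ! i \<noteq> y (p + i)}"
      have "v ! i = y (p + i)" if "j \<le> i" "i < L"
        using that i len k(1) \<open>L \<in> ?A\<close> by (simp add: v_def nth_append f(2))
      with i show "i \<in> {..<j} \<union> {L..<j + k}"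
        using len by fastforce
    qed
    then have "card {i. i < length v \<and> v ! i \<noteq> y (p + i)} \<le> card ({..<j} \<union> {L..<j + k})"
      by (intro card_mono) auto
    then have "card {i. i < length v \<and> v ! i \<noteq> y (p + i)} \<le> j + (j + k - L)"
      using card_Un_le[of "{..<j}" "{L..<j + k}"] by simp
    then have "card {i. i < length v \<and> v ! i \<noteq> y (p + i)} \<le> C"
      unfolding C_def using j(2) k(2) by linarith
    moreover have "L' \<le> length v" if "L' \<le> p" "\<forall>i<L'. y (p + i) = xs p i" for L'
      using L_ge[of L'] that k(1) len by simp
    moreover have "v \<noteq> []"
      using len j(1) s_pos by auto
    ultimately show ?thesis
      unfolding Q_def by blast
  qed
  from concatenation_from_blocks[where P = UNIV and Q = Q, OF UNIV_I this] obtain u q where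
    q: "q 0 = 0" "strict_mono q" and block: "\<And>i. Q (q i) (subsequence u (q i) (q (Suc i)))"
    by metis
  have q_le: "q i \<le> q (Suc i)" for i
    using q(2) by (simp add: strict_mono_less_eq)
  have step: "hamming u y (q (Suc i)) \<le> hamming u y (q i) + C" for i
  proof -
    let ?d = "q (Suc i) - q i"
    have "{j \<in> {q i..<q i + ?d}. u j \<noteq> y j} \<subseteq> (+) (q i) ` {j. j < ?d \<and> u (q i + j) \<noteq> y (q i + j)}"
    proof
      fix j
      assume "j \<in> {j \<in> {q i..<q i + ?d}. u j \<noteq> y j}"
      then show "j \<in> (+) (q i) ` {j. j < ?d \<and> u (q i + j) \<noteq> y (q i + j)}"
        by (intro image_eqI[of _ _ "j - q i"]) auto
    qed
    then have "card {j \<in> {q i..<q i + ?d}. u j \<noteq> y j} \<le> card {j. j < ?d \<and> u (q i + j) \<noteq> y (q i + j)}"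
      by (intro surj_card_le) auto
    also have "{j. j < ?d \<and> u (q i + j) \<noteq> y (q i + j)} =
        {j. j < length (subsequence u (q i) (q (Suc i))) \<and> subsequence u (q i) (q (Suc i)) ! j \<noteq> y (q i + j)}"
      by auto
    also have "card \<dots> \<le> C"
      using block[of i] unfolding Q_def by blast
    finally have "hamming u y (q i + ?d) \<le> hamming u y (q i) + C"
      using hamming_split_le[of u y "q i" ?d] by linarith
    then show ?thesis
      using q_le[of i] by simp
  qed
  \<comment> \<open>The starting points at which a block may be shorter than \<open>L\<close>;
    \<open>{..<L}\<close> accounts for the cap.\<close>
  define bad where "bad L = {..<L} \<union> - {p. \<forall>i<L. y (p + i) = xs p i}" for L
  have bad_zero: "density_zero (bad L)" for L
    unfolding bad_def using agree[of L]
    by (intro density_zero_Un density_zero_finite[OF finite_lessThan]) (simp add: density_one_iff)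
  \<comment> \<open>A block with a good start has at least \<open>L\<close> letters, so its
    \<open>C\<close> errors are charged to its length at rate \<open>C / L\<close>. A block with a
    bad start is charged \<open>C\<close> outright. Multiplying by \<open>L\<close> keeps the
    estimate in the natural numbers.\<close>
  have count: "L * hamming u y (q i) \<le> L * C * card (bad L \<inter> {..<q i}) + C * q i" for L i
  proof (induction i)
    case 0
    then show ?case
      by (simp add: q(1) hamming_def)
  next
    case (Suc i)
    have mono: "card (bad L \<inter> {..<q i}) \<le> card (bad L \<inter> {..<q (Suc i)})"
      using q_le[of i] by (intro card_mono) auto
    have "L * hamming u y (q (Suc i)) \<le> L * hamming u y (q i) + L * C"
      using mult_le_mono2[OF step, of L i] by (simp add: algebra_simps)
    also have "\<dots> \<le> L * C * card (bad L \<inter> {..<q i}) + C * q i + L * C"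
      using Suc by simp
    also have "\<dots> \<le> L * C * card (bad L \<inter> {..<q (Suc i)}) + C * q (Suc i)"
    proof (cases "q i \<in> bad L")
      case True
      have "q i < q (Suc i)"
        using q(2) by (simp add: strict_mono_less)
      then have "insert (q i) (bad L \<inter> {..<q i}) \<subseteq> bad L \<inter> {..<q (Suc i)}"
        using True by auto
      then have "card (insert (q i) (bad L \<inter> {..<q i})) \<le> card (bad L \<inter> {..<q (Suc i)})"
        by (intro card_mono) auto
      then have "Suc (card (bad L \<inter> {..<q i})) \<le> card (bad L \<inter> {..<q (Suc i)})"
        by simp
      from mult_le_mono2[OF this, of "L * C"]
      have "L * C + L * C * card (bad L \<inter> {..<q i}) \<le> L * C * card (bad L \<inter> {..<q (Suc i)})"
        unfolding mult_Suc_right .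
      with mult_le_mono2[OF q_le, of C i] show ?thesis
        by linarith
    next
      case False
      then have "L \<le> q (Suc i) - q i"
        using block[of i] unfolding Q_def bad_def by simp
      then have "q i + L \<le> q (Suc i)"
        using q_le[of i] by linarith
      from mult_le_mono2[OF this, of C] have "C * q i + L * C \<le> C * q (Suc i)"
        by (simp add: algebra_simps)
      with mult_le_mono2[OF mono, of "L * C"] show ?thesis
        by linarith
    qed
    finally show ?case .
  qed
  \<comment> \<open>The unfinished block containing \<open>N\<close> adds at most \<open>C\<close>
    errors.\<close>
  have bound: "L * hamming u y N \<le> L * C * card (bad L \<inter> {..<N}) + C * N + L * C" for L N
  proof -
    obtain i where i: "q i \<le> N" "N < q (Suc i)"
      using block_of_index[OF q] by blast
    have "hamming u y N \<le> hamming u y (q i) + C"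
      using hamming_mono[of N "q (Suc i)" u y] step[of i] i(2) by linarith
    then have "L * hamming u y N \<le> L * hamming u y (q i) + L * C"
      using mult_le_mono2 by (metis add_mult_distrib2)
    also have "\<dots> \<le> L * C * card (bad L \<inter> {..<q i}) + C * q i + L * C"
      using count by simp
    also have "\<dots> \<le> L * C * card (bad L \<inter> {..<N}) + C * N + L * C"
      using i(1) by (intro add_mono mult_le_mono2 card_mono) auto
    finally show ?thesis .
  qed
  have "density_zero {i. u i \<noteq> y i}"
    unfolding density_zero_def
  proof (intro allI impI)
    fix \<epsilon> :: real
    assume "\<epsilon> > 0"
    have "0 < C"
      unfolding C_def using s_pos by simp
    \<comment> \<open>Each of the three terms of \<open>bound\<close> gets a third of \<epsilon>:
      the one in \<open>C * N\<close> through this \<open>L\<close>, the other two for large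
      \<open>N\<close>.\<close>
    obtain L :: nat where L: "3 * real C / \<epsilon> < real L"
      using reals_Archimedean2 by blast
    have "0 \<le> 3 * real C / \<epsilon>"
      using \<open>\<epsilon> > 0\<close> by simp
    with L have "0 < L"
      by linarith
    have CL: "real C \<le> \<epsilon> / 3 * real L"
      using L \<open>\<epsilon> > 0\<close> by (simp add: field_simps)
    have "0 < \<epsilon> / (3 * real C)"
      using \<open>\<epsilon> > 0\<close> \<open>0 < C\<close> by simp
    then have "\<forall>\<^sub>F N in sequentially. real (card (bad L \<inter> {..<N})) \<le> \<epsilon> / (3 * real C) * real N"
      using bad_zero[of L] unfolding density_zero_def by blast
    moreover have "\<forall>\<^sub>F N in sequentially. 3 * real C / \<epsilon> \<le> real N"
      using filterlim_real_sequentially unfolding filterlim_at_top by blast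
    ultimately show "\<forall>\<^sub>F N in sequentially. real (card ({i. u i \<noteq> y i} \<inter> {..<N})) \<le> \<epsilon> * real N"
    proof eventually_elim
      case (elim N)
      have "real C * real (card (bad L \<inter> {..<N})) \<le> \<epsilon> / 3 * real N"
        using elim(1) \<open>0 < C\<close> by (simp add: field_simps)
      then have "real L * (real C * real (card (bad L \<inter> {..<N}))) \<le> real L * (\<epsilon> / 3 * real N)"
        by (intro mult_left_mono) auto
      moreover have "real C * real N \<le> real L * (\<epsilon> / 3 * real N)"
        using mult_right_mono[OF CL, of "real N"] by (simp add: algebra_simps)
      moreover have "real C \<le> \<epsilon> / 3 * real N"
        using elim(2) \<open>\<epsilon> > 0\<close> by (simp add: field_simps)
      then have "real L * real C \<le> real L * (\<epsilon> / 3 * real N)"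
        by (intro mult_left_mono) auto
      moreover have "real L * real (hamming u y N) \<le>
          real L * (real C * real (card (bad L \<inter> {..<N}))) + real C * real N + real L * real C"
        using bound[of L N] by (metis (mono_tags) of_nat_add of_nat_mult of_nat_le_iff mult.assoc)
      ultimately have "real L * real (hamming u y N) \<le> real L * (\<epsilon> * real N)"
        by (simp add: algebra_simps)
      then show ?case
        using \<open>0 < L\<close> by (simp add: hamming_def)
    qed
  qed
  moreover have "factorable B u"
    using q block by (intro factorable_blocks) (auto simp: Q_def)
  ultimately show ?thesis
    using that by blast
qed

end

section \<open>Vague pseudo-orbits\<close>

text \<open>The equations \<open>ys i 0 = ys 0 i\<close> for \<open>i < L\<close> involve finitely
  many letters, so they define an open set. It contains every orbit, since the first letter of the
  \<open>i\<close>-th shift of \<open>z\<close> is \<open>z i\<close>.\<close>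

lemma vague_pseudo_orbit_agreement:
  assumes invariant: "\<And>x. x \<in> X \<Longrightarrow> shift_map x \<in> X"
    and pseudo: "vague_pseudo_orbit X xs"
  shows "density_one {p. \<forall>i<L. xs (p + i) 0 = xs p i}"
proof -
  define U where "U = point_seqs X \<inter> (\<Inter>i\<in>{..<L}. {ys. ys i 0 = ys 0 i})"
  have open_eq: "open {ys :: nat \<Rightarrow> nat \<Rightarrow> bool. ys i 0 = ys 0 i}" for i
  proof -
    have eval: "continuous_on UNIV (\<lambda>ys :: nat \<Rightarrow> nat \<Rightarrow> bool. ys a b)" for a b
      by (rule continuous_on_product_then_coordinatewise[OF continuous_on_product_coordinates])
    have "open ((\<lambda>ys :: nat \<Rightarrow> nat \<Rightarrow> bool. (ys i 0, ys 0 i)) -` ({True} \<times> {True} \<union> {False} \<times> {False}))"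
      by (intro open_vimage continuous_on_Pair eval open_Un open_Times open_discrete)
    also have "(\<lambda>ys :: nat \<Rightarrow> nat \<Rightarrow> bool. (ys i 0, ys 0 i)) -` ({True} \<times> {True} \<union> {False} \<times> {False}) =
        {ys. ys i 0 = ys 0 i}"
      by auto
    finally show ?thesis .
  qed
  have "openin (top_of_set (point_seqs X)) U"
    unfolding U_def by (intro openin_open_Int open_INT) (use open_eq in auto)
  moreover have "orbit_seqs X \<subseteq> U"
  proof
    fix ys
    assume "ys \<in> orbit_seqs X"
    then obtain z where z: "z \<in> X" "ys = (\<lambda>n. (shift_map ^^ n) z)"
      unfolding orbit_seqs_def by blast
    have "(shift_map ^^ n) z \<in> X" for n
      by (induction n) (use z(1) invariant in auto)
    then show "ys \<in> U"
      unfolding U_def point_seqs_def z(2) by (auto simp: funpow_shift_map)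
  qed
  ultimately have "density_one {n. (shift_map ^^ n) xs \<in> U}"
    using pseudo unfolding vague_pseudo_orbit_def by blast
  moreover have "{n. (shift_map ^^ n) xs \<in> U} = {p. \<forall>i<L. xs (p + i) 0 = xs p i}"
    using pseudo unfolding vague_pseudo_orbit_def U_def point_seqs_def by (auto simp: funpow_shift_map)
  ultimately show ?thesis
    by simp
qed

lemma rho_less_if_agree:
  assumes "\<forall>i<L. x i = y i" "1 / 2 ^ L < \<epsilon>"
  shows "rho x y < \<epsilon>"
proof (cases "x = y")
  case True
  have "0 < \<epsilon>"
    using assms(2) by (meson less_trans zero_less_divide_1_iff zero_less_numeral zero_less_power)
  with True show ?thesis
    by (simp add: rho_def)
next
  case False
  then obtain n where "x n \<noteq> y n"
    by blast
  then have "x (LEAST n. x n \<noteq> y n) \<noteq> y (LEAST n. x n \<noteq> y n)"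
    by (rule LeastI)
  then have "L \<le> (LEAST n. x n \<noteq> y n)"
    using assms(1) not_less by blast
  then have "(1::real) / 2 ^ (LEAST n. x n \<noteq> y n) \<le> 1 / 2 ^ L"
    by (intro divide_left_mono power_increasing) auto
  with False assms(2) show ?thesis
    by (simp add: rho_def)
qed

text \<open>If \<open>y\<close> follows \<open>xs n\<close> for \<open>L\<close> letters from
  \<open>n\<close> on and \<open>z\<close> agrees with \<open>y\<close> there, then the
  \<open>n\<close>-th shift of \<open>z\<close> is within \<open>1 / 2 ^ L\<close> of
  \<open>xs n\<close>. Failures lie in a finite union of translates of sets of density zero.\<close>

lemma vague_specification_propertyI:
  assumes invariant: "\<And>x. x \<in> X \<Longrightarrow> shift_map x \<in> X"
    and trace: "\<And>xs y. \<lbrakk>\<And>p. xs p \<in> X; \<And>L. density_one {p. \<forall>i<L. y (p + i) = xs p i}\<rbrakk>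
      \<Longrightarrow> \<exists>z\<in>X. density_zero {i. z i \<noteq> y i}"
  shows "vague_specification_property X"
  unfolding vague_specification_property_def
proof (intro allI impI)
  fix xs
  assume pseudo: "vague_pseudo_orbit X xs"
  define y where "y p = xs p 0" for p
  have agree: "density_one {p. \<forall>i<L. y (p + i) = xs p i}" for L
    unfolding y_def using invariant pseudo by (rule vague_pseudo_orbit_agreement)
  have "xs p \<in> X" for p
    using pseudo unfolding vague_pseudo_orbit_def point_seqs_def by blast
  then obtain z where z: "z \<in> X" "density_zero {i. z i \<noteq> y i}"
    using trace agree by blast
  have "density_one {n. rho ((shift_map ^^ n) z) (xs n) < \<epsilon>}" if "\<epsilon> > 0" for \<epsilon>
  proof -
    obtain L where L: "(1 / 2) ^ L < \<epsilon>"
      using real_arch_pow_inv[OF \<open>\<epsilon> > 0\<close>, of "1 / 2"] by auto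
    let ?D = "- {p. \<forall>i<L. y (p + i) = xs p i} \<union> (\<Union>i\<in>{..<L}. {n. n + i \<in> {i. z i \<noteq> y i}})"
    have "rho ((shift_map ^^ n) z) (xs n) < \<epsilon>" if "n \<notin> ?D" for n
    proof (rule rho_less_if_agree)
      show "\<forall>i<L. (shift_map ^^ n) z i = xs n i"
        using that by (auto simp: funpow_shift_map)
      show "1 / 2 ^ L < \<epsilon>"
        using L by (simp add: power_one_over)
    qed
    then have "- {n. rho ((shift_map ^^ n) z) (xs n) < \<epsilon>} \<subseteq> ?D"
      by blast
    moreover have "density_zero ?D"
      using agree[of L] z(2)
      by (intro density_zero_Un density_zero_UN density_zero_shift) (auto simp: density_one_iff)
    ultimately show ?thesis
      unfolding density_one_iff by (rule density_zero_mono[rotated])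
  qed
  with z(1) show "\<exists>z\<in>X. \<forall>\<epsilon>>0. density_one {n. rho ((shift_map ^^ n) z) (xs n) < \<epsilon>}"
    by blast
qed

section \<open>Passage to the limit\<close>

text \<open>Sums of \<open>t\<close> word lengths fill \<open>{t * s..t * l}\<close>, and appending
  the fixed word \<open>\<tau>\<close> translates this interval.\<close>

lemma (in interval_code) interval_code_next_words:
  assumes "0 < t"
  shows "interval_code (next_words t \<tau> B) (t * s + length \<tau>) (t * l + length \<tau>)"
proof
  have eq: "next_words t \<tau> B = (\<lambda>bs. concat bs @ \<tau>) ` {bs. set bs \<subseteq> B \<and> length bs = t}"
    unfolding next_words_def by auto
  show "finite (next_words t \<tau> B)"
    unfolding eq by (intro finite_imageI finite_lists_length_eq finite_B)
  show "length ` next_words t \<tau> B = {t * s + length \<tau>..t * l + length \<tau>}"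
  proof (intro equalityI subsetI)
    fix m
    assume "m \<in> length ` next_words t \<tau> B"
    then show "m \<in> {t * s + length \<tau>..t * l + length \<tau>}"
      unfolding eq using length_concat_bounds by auto
  next
    fix m
    assume m: "m \<in> {t * s + length \<tau>..t * l + length \<tau>}"
    then have "t * s \<le> m - length \<tau>" "m - length \<tau> \<le> t * l"
      by auto
    then obtain bs where bs: "length bs = t" "set bs \<subseteq> B" "length (concat bs) = m - length \<tau>"
      by (rule length_concat_surj)
    with m show "m \<in> length ` next_words t \<tau> B"
      unfolding eq by (intro image_eqI[of _ _ "concat bs @ \<tau>"] imageI) auto
  qed
  show "0 < t * s + length \<tau>" "t * s + length \<tau> < t * l + length \<tau>"
    using assms s_pos s_less_l by auto
qed

lemma next_words_subset_concats:
  assumes "\<tau> \<in> concats B"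
  shows "next_words t \<tau> B \<subseteq> concats B"
  unfolding next_words_def using assms by (auto intro: append_in_concats concat_in_concats)

text \<open>
  At stage \<open>n + 1\<close> the previous point is converted to words of \<open>B (n + 1)\<close> only before a
  late position \<open>K\<close>. After \<open>K\<close> it is replaced by an approximation to \<open>y\<close> of density zero error, so
  every stage stays close to \<open>y\<close> in density and the errors of the stages do not accumulate in the limit.
\<close>

lemma factorable_diagonal:
  fixes B :: "nat \<Rightarrow> bool list set"
  assumes code: "\<And>n. interval_code (B n) (s n) (l n)"
    and refine: "\<And>n. B (Suc n) \<subseteq> concats (B n)"
    and approx: "\<And>n. \<exists>u. factorable (B n) u \<and> density_zero {i. u i \<noteq> y i}"
    and convert: "\<And>n x. factorable (B n) x \<Longrightarrow> \<exists>x'. factorable (B (Suc n)) x' \<and>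
      (\<forall>i<n. x' i = x i) \<and> (\<forall>N. real (hamming x x' N) \<le> (1 / 2) ^ n * real N)"
  obtains z where "\<And>n. factorable (B n) z" "density_zero {i. z i \<noteq> y i}"
proof -
  have "\<exists>f. \<forall>n. (factorable (B n) (f n) \<and> density_zero {i. f n i \<noteq> y i}) \<and>
    ((\<forall>i<n. f (Suc n) i = f n i) \<and>
     (\<forall>N. real (hamming (f (Suc n)) y N) \<le> real (hamming (f n) y N) + 3 * (1 / 2) ^ n * real N))"
  proof (rule dependent_nat_choice)
    show "\<exists>x. factorable (B 0) x \<and> density_zero {i. x i \<noteq> y i}"
      by (rule approx)
  next
    fix x n
    assume x: "factorable (B n) x \<and> density_zero {i. x i \<noteq> y i}"
    define \<eta> :: real where "\<eta> = (1 / 2) ^ n"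
    have "\<eta> > 0"
      by (simp add: \<eta>_def)
    obtain x' where x': "factorable (B (Suc n)) x'" "\<And>i. i < n \<Longrightarrow> x' i = x i"
      "\<And>N. real (hamming x x' N) \<le> \<eta> * real N"
      using convert x unfolding \<eta>_def by blast
    obtain u where u: "factorable (B (Suc n)) u" "density_zero {i. u i \<noteq> y i}"
      using approx by blast
    define c where "c = s (Suc n) * s (Suc n) + 2 * l (Suc n)"
    have "\<forall>\<^sub>F N in sequentially. real (hamming x y N) \<le> \<eta> * real N"
      using x \<open>\<eta> > 0\<close> unfolding density_zero_def hamming_def by blast
    moreover have "\<forall>\<^sub>F N in sequentially. real (hamming u y N) \<le> \<eta> / 2 * real N"
      using u(2) \<open>\<eta> > 0\<close> unfolding density_zero_def hamming_def by (meson half_gt_zero)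
    moreover have "\<forall>\<^sub>F N in sequentially. 2 * real c / \<eta> \<le> real N"
      using filterlim_real_sequentially unfolding filterlim_at_top by blast
    ultimately have "\<forall>\<^sub>F N in sequentially. real (hamming x y N) \<le> \<eta> * real N \<and>
        real (hamming u y N) + real c \<le> \<eta> * real N"
      by eventually_elim (use \<open>\<eta> > 0\<close> in \<open>simp add: field_simps\<close>)
    then obtain K0 where K0: "\<And>N. K0 \<le> N \<Longrightarrow> real (hamming x y N) \<le> \<eta> * real N \<and>
        real (hamming u y N) + real c \<le> \<eta> * real N"
      unfolding eventually_sequentially by blast
    \<comment> \<open>At least \<open>n\<close>, to keep the first \<open>n\<close> letters, and at
      least \<open>K0\<close>, for the density estimates.\<close>
    define K where "K = max n K0"
    obtain v where v: "factorable (B (Suc n)) v" "\<And>i. i < K \<Longrightarrow> v i = x' i"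
      "\<And>i. K + c \<le> i \<Longrightarrow> v i = u i"
      using interval_code.factorable_glue[OF code x'(1) u(1)] unfolding c_def by blast
    have "density_zero ({..<K + c} \<union> {i. u i \<noteq> y i})"
      by (intro density_zero_Un density_zero_finite finite_lessThan u(2))
    moreover have "{i. v i \<noteq> y i} \<subseteq> {..<K + c} \<union> {i. u i \<noteq> y i}"
    proof
      fix i
      assume "i \<in> {i. v i \<noteq> y i}"
      then show "i \<in> {..<K + c} \<union> {i. u i \<noteq> y i}"
        using v(3)[of i] by (cases "i < K + c") auto
    qed
    ultimately have "density_zero {i. v i \<noteq> y i}"
      by (rule density_zero_mono)
    moreover have "\<forall>i<n. v i = x i"
      using v(2) x'(2) by (simp add: K_def)
    \<comment> \<open>Up to \<open>K\<close> only the conversion error is added. Beyond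
      \<open>K\<close> there are three contributions of at most \<open>\<eta> * N\<close>: the
      conversion, the errors of \<open>x\<close> before \<open>K\<close>, and those of
      \<open>u\<close> together with the transition.\<close>
    moreover have "real (hamming v y N) \<le> real (hamming x y N) + 3 * \<eta> * real N" for N
    proof -
      have early: "real (hamming v y M) \<le> real (hamming x y M) + \<eta> * real M" if "M \<le> K" for M
      proof -
        have "hamming v y M = hamming x' y M"
          using v(2) that by (intro hamming_cong) simp
        also have "\<dots> \<le> hamming x' x M + hamming x y M"
          by (rule hamming_triangle)
        also have "hamming x' x M = hamming x x' M"
          unfolding hamming_def by (rule arg_cong[where f = card]) auto
        finally show ?thesis
          using x'(3)[of M] by linarith
      qed
      show ?thesis
      proof (cases "N \<le> K")
        case True
        have "0 \<le> 2 * \<eta> * real N"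
          using \<open>\<eta> > 0\<close> by simp
        with early[OF True] show ?thesis
          by linarith
      next
        case False
        have "hamming v y N \<le> card (({i. v i \<noteq> y i} \<inter> {..<K}) \<union> ({i. u i \<noteq> y i} \<inter> {..<N} \<union> {K..<K + c}))"
          unfolding hamming_def
        proof (intro card_mono subsetI)
          fix i
          assume "i \<in> {i. v i \<noteq> y i} \<inter> {..<N}"
          then show "i \<in> ({i. v i \<noteq> y i} \<inter> {..<K}) \<union> ({i. u i \<noteq> y i} \<inter> {..<N} \<union> {K..<K + c})"
            using v(3)[of i] by (cases "i < K"; cases "i < K + c") auto
        qed auto
        also have "\<dots> \<le> hamming v y K + card ({i. u i \<noteq> y i} \<inter> {..<N} \<union> {K..<K + c})"
          unfolding hamming_def by (rule card_Un_le)
        also have "\<dots> \<le> hamming v y K + (hamming u y N + c)"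
          unfolding hamming_def using card_Un_le[of "{i. u i \<noteq> y i} \<inter> {..<N}" "{K..<K + c}"] by simp
        finally have "real (hamming v y N) \<le> real (hamming v y K) + (real (hamming u y N) + real c)"
          by linarith
        moreover have "real (hamming u y N) + real c \<le> \<eta> * real N"
          using K0[of N] False by (simp add: K_def)
        moreover have "real (hamming x y K) \<le> \<eta> * real K"
          using K0[of K] by (simp add: K_def)
        moreover have "\<eta> * real K \<le> \<eta> * real N"
          using False \<open>\<eta> > 0\<close> by simp
        ultimately show ?thesis
          using early[of K] by linarith
      qed
    qed
    ultimately show "\<exists>v. (factorable (B (Suc n)) v \<and> density_zero {i. v i \<noteq> y i}) \<and> (\<forall>i<n. v i = x i) \<and>
        (\<forall>N. real (hamming v y N) \<le> real (hamming x y N) + 3 * (1 / 2) ^ n * real N)"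
      using v(1) unfolding \<eta>_def by blast
  qed
  then obtain f where f: "\<And>n. factorable (B n) (f n)" "\<And>n. density_zero {i. f n i \<noteq> y i}"
    "\<And>n i. i < n \<Longrightarrow> f (Suc n) i = f n i"
    "\<And>n N. real (hamming (f (Suc n)) y N) \<le> real (hamming (f n) y N) + 3 * (1 / 2) ^ n * real N"
    by blast
  define z where "z i = f (Suc i) i" for i
  have stable: "f m i = z i" if "i < m" for m i
  proof -
    have "Suc i \<le> m"
      using that by simp
    then show ?thesis
      by (induction m rule: dec_induct) (auto simp: z_def f(3))
  qed
  have refine': "factorable (B m) x" if "m \<le> n" "factorable (B n) x" for m n x
    using that by (induction n rule: dec_induct) (use refine factorable_mono in blast)+
  have "factorable (B m) z" for m
  proof (rule factorable_limit)
    show "finite (B m)"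
      using code by (rule interval_code.finite_B)
    show "0 < length b" if "b \<in> B m" for b
      using interval_code.word_length_pos[OF code that] by blast
    show "\<exists>x. factorable (B m) x \<and> (\<forall>i<N. x i = z i)" for N
      using refine'[OF _ f(1), of m "max m N"] stable by (intro exI[of _ "f (max m N)"]) auto
  qed
  moreover have "density_zero {i. z i \<noteq> y i}"
    unfolding density_zero_def
  proof (intro allI impI)
    fix \<epsilon> :: real
    assume "\<epsilon> > 0"
    \<comment> \<open>The later stages add at most the sum of \<open>3 * (1 / 2) ^ k\<close> over
      \<open>k \<ge> n\<close>, which is \<open>6 * (1 / 2) ^ n\<close>, to be at most \<epsilon> /
      2.\<close>
    then obtain n where n: "(1 / 2) ^ n < \<epsilon> / 12"
      using real_arch_pow_inv[of "\<epsilon> / 12" "1 / 2"] by auto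
    have bound: "real (hamming z y N) \<le> real (hamming (f n) y N) + \<epsilon> / 2 * real N" for N
    proof -
      have telescope: "real (hamming (f m) y N) \<le>
          real (hamming (f n) y N) + 6 * ((1 / 2) ^ n - (1 / 2) ^ m) * real N" if "n \<le> m" for m
        using that
      proof (induction m rule: dec_induct)
        case (step m)
        have "6 * ((1 / 2) ^ n - (1 / 2) ^ Suc m) * real N =
            6 * ((1 / 2) ^ n - (1 / 2) ^ m) * real N + 3 * (1 / 2) ^ m * real N"
          by (simp add: algebra_simps)
        with step.IH f(4)[of m N] show ?case
          by linarith
      qed simp
      \<comment> \<open>Late enough for stage \<open>m\<close> to agree with \<open>z\<close> on the
        first \<open>N\<close> letters.\<close>
      define m where "m = max n N"
      have "hamming z y N = hamming (f m) y N"
        by (rule hamming_cong) (simp add: stable m_def)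
      moreover have "6 * ((1 / 2) ^ n - (1 / 2) ^ m) * real N \<le> \<epsilon> / 2 * real N"
      proof (rule mult_right_mono)
        have "(0::real) \<le> (1 / 2) ^ m"
          by simp
        with n show "6 * ((1 / 2) ^ n - (1 / 2) ^ m) \<le> \<epsilon> / 2"
          by argo
      qed simp
      ultimately show ?thesis
        using telescope[of m] by (simp add: m_def)
    qed
    have "\<forall>\<^sub>F N in sequentially. real (hamming (f n) y N) \<le> \<epsilon> / 2 * real N"
      using f(2)[of n] \<open>\<epsilon> > 0\<close> unfolding density_zero_def hamming_def by (meson half_gt_zero)
    then show "\<forall>\<^sub>F N in sequentially. real (card ({i. z i \<noteq> y i} \<inter> {..<N})) \<le> \<epsilon> * real N"
    proof eventually_elim
      case (elim N)
      with bound[of N] show ?case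
        by (simp add: hamming_def)
    qed
  qed
  ultimately show ?thesis
    using that by blast
qed

section \<open>The codes of the construction\<close>

lemma (in interval_code) Min_length: "Min (length ` B) = s"
  unfolding lengths using s_less_l by (intro Min_eqI) auto

lemma (in interval_code) Max_length: "Max (length ` B) = l"
  unfolding lengths using s_less_l by (intro Max_eqI) auto

theorem corollary6p15:
  fixes t :: "nat \<Rightarrow> nat"
    and B :: "nat \<Rightarrow> bool list set"
    and \<beta> :: "nat \<Rightarrow> bool list list"
    and \<tau> :: "nat \<Rightarrow> bool list"
    and s l :: "nat \<Rightarrow> nat"
  assumes t_ge_2: "\<And>n. n \<ge> 1 \<Longrightarrow> t n \<ge> 2"
    and B_1: "B 1 = {[False], [True, True]}"
    and enumeration: "\<And>n. n \<ge> 1 \<Longrightarrow> distinct (\<beta> n) \<and> set (\<beta> n) = B n"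
    and tau: "\<And>n. n \<ge> 1 \<Longrightarrow> \<tau> n = concat (\<beta> n)"
    and B_Suc: "\<And>n. n \<ge> 1 \<Longrightarrow> B (Suc n) = next_words (t n) (\<tau> n) (B n)"
    and s: "\<And>n. n \<ge> 1 \<Longrightarrow> s n = Min (length ` B n)"
    and l: "\<And>n. n \<ge> 1 \<Longrightarrow> l n = Max (length ` B n)"
    and cond1: "\<And>n. n \<ge> 1 \<Longrightarrow>
      real (t n) > real (length (\<tau> n)) / (2 * real (l n) - 3 * real (s n))"
    and cond2: "\<And>n. n \<ge> 1 \<Longrightarrow>
      real (t n) \<ge> real (l n) / (real (l n) - real (s n))"
    and cond3: "\<And>n. n \<ge> 1 \<Longrightarrow>
      real (t n) \<ge> (2 * real (s n) + 2 * real (l n) + 3 * real (length (\<tau> n))) / real (l n)"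
    and cond4: "\<And>n. n \<ge> 1 \<Longrightarrow>
      real (t n) > (3 * real (l n) + real (length (\<tau> n))) / (real (s n) * (1 / 2) ^ n)"
  shows "vague_specification_property (\<Inter>n\<in>{1..}. concat_shift_space (B n))"
proof (rule vague_specification_propertyI)
  let ?X = "\<Inter>n\<in>{1..}. concat_shift_space (B n)"
  show "shift_map x \<in> ?X" if "x \<in> ?X" for x
    using that shift_concat_shift_space by blast
  \<comment> \<open>The bound \<open>n \<le> s n\<close> later ensures that enough initial letters
    are preserved for the stages to converge.\<close>
  have word_code: "interval_code (B n) (s n) (l n) \<and> 3 * s n < 2 * l n \<and> n \<le> s n" if "n \<ge> 1" for n
    using that
  proof (induction n rule: dec_induct)
    case base
    have code: "interval_code (B 1) 1 2"
    proof
      show "length ` B 1 = {1..2}"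
        unfolding B_1 by auto
    qed (simp_all only: B_1, simp_all)
    have "s 1 = 1" "l 1 = 2"
      using s[of 1] l[of 1] interval_code.Min_length[OF code] interval_code.Max_length[OF code] by simp_all
    with code show ?case
      by simp
  next
    case (step n)
    then interpret interval_code "B n" "s n" "l n"
      by simp
    have "n \<ge> 1" "0 < t n"
      using step.hyps t_ge_2[of n] by auto
    let ?s = "t n * s n + length (\<tau> n)" and ?l = "t n * l n + length (\<tau> n)"
    have code: "interval_code (B (Suc n)) ?s ?l"
      unfolding B_Suc[OF \<open>n \<ge> 1\<close>] using \<open>0 < t n\<close> by (rule interval_code_next_words)
    have "s (Suc n) = ?s" "l (Suc n) = ?l"
      using s[of "Suc n"] l[of "Suc n"] interval_code.Min_length[OF code] interval_code.Max_length[OF code]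
      by simp_all
    \<comment> \<open>Condition (1), cleared of its positive denominator, is exactly this inequality
      for the next code.\<close>
    moreover have "3 * ?s < 2 * ?l"
    proof -
      have "0 < 2 * real (l n) - 3 * real (s n)"
        using step.IH by linarith
      then have "real (length (\<tau> n)) < real (t n) * (2 * real (l n) - 3 * real (s n))"
        using cond1[OF \<open>n \<ge> 1\<close>] by (simp add: pos_divide_less_eq)
      then have "real (3 * ?s) < real (2 * ?l)"
        by (simp add: algebra_simps)
      then show ?thesis
        by (simp only: of_nat_less_iff)
    qed
    moreover have "Suc n \<le> ?s"
      using step.IH mult_le_mono1[OF t_ge_2[OF \<open>n \<ge> 1\<close>], of "s n"] \<open>n \<ge> 1\<close> by linarith
    ultimately show ?case
      using code by simp
  qed
  fix xs y
  assume xs: "\<And>p. xs p \<in> ?X"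
    and agree: "\<And>L. density_one {p. \<forall>i<L. y (p + i) = xs p i}"
  obtain z where z: "\<And>n. factorable (B (Suc n)) z" "density_zero {i. z i \<noteq> y i}"
  \<comment> \<open>The construction starts at index 1, the diagonal argument at 0.\<close>
  proof (rule factorable_diagonal[where B = "\<lambda>n. B (Suc n)"])
    show "interval_code (B (Suc n)) (s (Suc n)) (l (Suc n))" for n
      using word_code by simp
    show "B (Suc (Suc n)) \<subseteq> concats (B (Suc n))" for n
      using B_Suc[of "Suc n"] tau[of "Suc n"] enumeration[of "Suc n"]
      by (simp add: next_words_subset_concats concat_in_concats)
    show "\<exists>u. factorable (B (Suc n)) u \<and> density_zero {i. u i \<noteq> y i}" for n
    proof -
      interpret interval_code "B (Suc n)" "s (Suc n)" "l (Suc n)"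
        using word_code by simp
      have "xs p \<in> concat_shift_space (B (Suc n))" for p
        using xs by auto
      then show ?thesis
        using factorable_density_zero_approximation agree by blast
    qed
    show "\<exists>x'. factorable (B (Suc (Suc n))) x' \<and> (\<forall>i<n. x' i = x i) \<and>
        (\<forall>N. real (hamming x x' N) \<le> (1 / 2) ^ n * real N)" if x: "factorable (B (Suc n)) x" for n x
    proof -
      let ?n = "Suc n"
      have n: "?n \<ge> 1"
        by simp
      interpret interval_code "B ?n" "s ?n" "l ?n"
        using word_code by simp
      have large: "real (3 * l ?n + length (\<tau> ?n)) < real (t ?n * s ?n) * (1 / 2) ^ ?n"
        using cond4[OF n] s_pos by (simp add: divide_less_eq field_simps)
      also have "\<dots> \<le> real (t ?n * s ?n) * (1 / 2)"
        by (intro mult_left_mono) (simp_all add: power_le_one)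
      \<comment> \<open>Condition (4) gives \<open>6 * l < t * s\<close>, and
        \<open>s < l\<close>.\<close>
      finally have "6 * real (s ?n) < real (t ?n) * real (s ?n)"
        using s_less_l by simp
      then have "6 < t ?n"
        using s_pos by simp
      \<comment> \<open>Giving up three words costs at most a factor 2, which turns the exponent
        \<open>Suc n\<close> of condition (4) into \<open>n\<close>.\<close>
      have "real (t ?n * s ?n) \<le> 2 * real ((t ?n - 3) * s ?n)"
      proof -
        have "t ?n * s ?n \<le> (2 * (t ?n - 3)) * s ?n"
          using \<open>6 < t ?n\<close> by (intro mult_le_mono1) simp
        then show ?thesis
          by (metis mult.assoc of_nat_le_iff of_nat_mult of_nat_numeral)
      qed
      then have "real (t ?n * s ?n) * (1 / 2) ^ ?n \<le> 2 * real ((t ?n - 3) * s ?n) * (1 / 2) ^ ?n"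
        by (intro mult_right_mono) simp_all
      also have "\<dots> = (1 / 2) ^ n * real ((t ?n - 3) * s ?n)"
        by simp
      finally have "real (3 * l ?n + length (\<tau> ?n)) \<le> (1 / 2) ^ n * real ((t ?n - 3) * s ?n)"
        using large by linarith
      moreover have "3 * s ?n \<le> 2 * l ?n"
        using word_code[OF n] by simp
      moreover have "3 \<le> t ?n"
        using \<open>6 < t ?n\<close> by simp
      ultimately obtain x' where x': "factorable (next_words (t ?n) (\<tau> ?n) (B ?n)) x'"
        "\<And>i. i < (t ?n - 3) * s ?n \<Longrightarrow> x' i = x i"
        "\<And>N. real (hamming x x' N) \<le> (1 / 2) ^ n * real N"
        using factorable_next_words[OF x] by blast
      have "1 * n \<le> (t ?n - 3) * s ?n"
        using \<open>6 < t ?n\<close> word_code[OF n] by (intro mult_le_mono) auto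
      with x' show ?thesis
        unfolding B_Suc[OF n] by (intro exI[of _ x']) auto
    qed
  qed blast
  have "z \<in> concat_shift_space (B n)" if "n \<ge> 1" for n
  proof (rule factorable_imp_in_concat_shift_space)
    show "finite (B n)"
      using word_code[OF that] interval_code.finite_B by blast
    show "factorable (B n) z"
      using z(1)[of "n - 1"] that by simp
  qed
  with z(2) show "\<exists>z\<in>?X. density_zero {i. z i \<noteq> y i}"
    by blast
qed

end
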